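(* Let $\Delta$ be a simplicial complex on vertex set $[n]$. If $\Delta$ is skeleton-E-chordal, then its Alexander dual $\Delta^\vee$ is vertex-decomposable. The converse is false, already for $\dim(\Delta^\vee)=1$: there is a simplicial complex $\Delta$ such that $\Delta^\vee$ is $1$-dimensional and vertex-decomposable, but $\Delta$ is not skeleton-E-chordal.
   Context: Simplicial complexes are finite and not necessarily pure. A vertex labeling of a complex with $n$ vertices is a bijection of its vertices with $[n]$; $\max f$ is the largest label in $f$; the size of a face is its number of vertices. $\Delta$ is skeleton-E-chordal if it has a vertex labeling such that for every two faces $f\neq g$ of $\Delta$ with the same size and the same maximum, every subset $h\subseteq f\cup g$ with $|h|=|f|$ is a face of $\Delta$. The Alexander dual of $\Delta$ on vertex set $[n]$ is $\Delta^\vee=\{F\subseteq[n] : [n]\setminus F\notin\Delta\}$. A vertex $v$ of a complex $\Gamma$ is shedding if no facet of $\operatorname{link}(v,\Gamma)$ is also a facet of $\operatorname{del}(v,\Gamma)$, where $\operatorname{del}(v,\Gamma)$ is the subcomplex of all faces not containing $v$. A (not necessarily pure) complex $\Gamma$ is vertex-decomposable if it is a simplex, or $\Gamma=\{\emptyset\}$, or $\Gamma=\emptyset$, or (recursively) it has a shedding vertex $v$ such that $\operatorname{del}(v,\Gamma)$ and $\operatorname{link}(v,\Gamma)$ are both vertex-decomposable. *)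

theory Defs
  imports Main
begin

(* Elements of V need not be faces: a complex on V may have fewer vertices than V. The void
   complex {} and the complex {{}} are both allowed, as Alexander duality requires. *)
definition simplicial_complex_on :: "'a set \<Rightarrow> 'a set set \<Rightarrow> bool" where
  "simplicial_complex_on V \<Delta> \<longleftrightarrow>
     finite V \<and> \<Delta> \<subseteq> Pow V \<and> (\<forall>F\<in>\<Delta>. \<forall>G. G \<subseteq> F \<longrightarrow> G \<in> \<Delta>)"

definition vertices :: "'a set set \<Rightarrow> 'a set" where
  "vertices \<Delta> = {v. {v} \<in> \<Delta>}"

(* Meaningful only for nonempty finite complexes; Max of the empty set is unspecified. *)
definition complex_dim :: "'a set set \<Rightarrow> int" where
  "complex_dim \<Delta> = Max ((\<lambda>F. int (card F) - 1) ` \<Delta>)"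

definition vertex_labeling :: "'a set set \<Rightarrow> ('a \<Rightarrow> nat) \<Rightarrow> bool" where
  "vertex_labeling \<Delta> l \<longleftrightarrow> bij_betw l (vertices \<Delta>) {1..card (vertices \<Delta>)}"

(* Two distinct faces of equal size are nonempty, so Max is applied to nonempty sets only. *)
definition skeleton_E_chordal :: "'a set set \<Rightarrow> bool" where
  "skeleton_E_chordal \<Delta> \<longleftrightarrow>
     (\<exists>l. vertex_labeling \<Delta> l \<and>
       (\<forall>f\<in>\<Delta>. \<forall>g\<in>\<Delta>. f \<noteq> g \<and> card f = card g \<and> Max (l ` f) = Max (l ` g) \<longrightarrow>
         (\<forall>h. h \<subseteq> f \<union> g \<and> card h = card f \<longrightarrow> h \<in> \<Delta>)))"

definition alexander_dual :: "'a set \<Rightarrow> 'a set set \<Rightarrow> 'a set set" where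
  "alexander_dual V \<Delta> = {F. F \<subseteq> V \<and> V - F \<notin> \<Delta>}"

definition facets :: "'a set set \<Rightarrow> 'a set set" where
  "facets \<Gamma> = {F \<in> \<Gamma>. \<forall>G\<in>\<Gamma>. F \<subseteq> G \<longrightarrow> G = F}"

definition link :: "'a \<Rightarrow> 'a set set \<Rightarrow> 'a set set" where
  "link v \<Gamma> = {F. v \<notin> F \<and> insert v F \<in> \<Gamma>}"

definition del :: "'a \<Rightarrow> 'a set set \<Rightarrow> 'a set set" where
  "del v \<Gamma> = {F \<in> \<Gamma>. v \<notin> F}"

definition shedding :: "'a \<Rightarrow> 'a set set \<Rightarrow> bool" where
  "shedding v \<Gamma> \<longleftrightarrow> v \<in> vertices \<Gamma> \<and> facets (link v \<Gamma>) \<inter> facets (del v \<Gamma>) = {}"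

inductive vertex_decomposable :: "'a set set \<Rightarrow> bool" where
  simplex: "finite F \<Longrightarrow> vertex_decomposable (Pow F)"
| irrelevant: "vertex_decomposable {{}}"
| void: "vertex_decomposable {}"
| shed: "shedding v \<Gamma> \<Longrightarrow> vertex_decomposable (del v \<Gamma>) \<Longrightarrow> vertex_decomposable (link v \<Gamma>)
    \<Longrightarrow> vertex_decomposable \<Gamma>"

lemma simplicial_complex_on_alexander_dual:
  assumes "simplicial_complex_on V \<Delta>"
  shows "simplicial_complex_on V (alexander_dual V \<Delta>)"
proof -
  have closed: "G \<in> \<Delta>" if "F \<in> \<Delta>" "G \<subseteq> F" for F G
    using assms that by (simp add: simplicial_complex_on_def)
  have "G \<in> alexander_dual V \<Delta>" if F: "F \<in> alexander_dual V \<Delta>" and G: "G \<subseteq> F" for F G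
  proof -
    have "V - F \<subseteq> V - G" using G by (rule Diff_mono[OF order_refl])
    then have "V - G \<notin> \<Delta>" using closed[of "V - G" "V - F"] F by (auto simp: alexander_dual_def)
    then show ?thesis using F G by (auto simp: alexander_dual_def)
  qed
  moreover have "alexander_dual V \<Delta> \<subseteq> Pow V" by (auto simp: alexander_dual_def)
  ultimately show ?thesis using assms by (simp add: simplicial_complex_on_def)
qed

end

theory Submission
  imports Defs
begin

text \<open>
  Alexander duality exchanges links and deletions, and \<open>v\<close> is shedding in the dual of \<open>\<Delta>\<close> as soon as
  every non-face \<open>N\<close> avoiding \<open>v\<close> has an element that can be replaced by \<open>v\<close> so that the set stays
  a non-face. If \<open>\<Delta>\<close> is skeleton-E-chordal and \<open>v\<close> is the vertex with the largest label, this
  exchange property holds: otherwise all sets \<open>N - w + v\<close> are faces of the same size and with the same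
  maximum, and two of them have a union containing \<open>N\<close>. Links and deletions of \<open>v\<close>
  inherit the chordality condition, and elements of the ground set that are not vertices of \<open>\<Delta>\<close>
  have the exchange property trivially if \<open>\<Delta>\<close> is nonempty, so induction on the ground set applies.

  For the converse, the dual of a star with four leaves is not skeleton-E-chordal: if \<open>i\<close> is
  the leaf with the largest label and \<open>j\<close>, \<open>k\<close> are two other leaves, then the faces
  \<open>{c, i, j}\<close> and \<open>{c, i, k}\<close> have the same maximum, but \<open>{i, j, k}\<close> is not a face.
\<close>

section \<open>Alexander duality and shedding vertices\<close>

lemma link_alexander_dual:
  assumes "v \<in> V"
  shows "link v (alexander_dual V \<Delta>) = alexander_dual (V - {v}) (del v \<Delta>)"
proof -
  have "insert v F \<subseteq> V \<and> v \<notin> F \<and> V - insert v F \<notin> \<Delta> \<longleftrightarrow>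
      F \<subseteq> V - {v} \<and> V - {v} - F \<notin> del v \<Delta>" for F
    using assms by (auto simp: del_def Diff_insert2[symmetric])
  then show ?thesis by (auto simp: link_def alexander_dual_def)
qed

lemma del_alexander_dual:
  assumes "v \<in> V"
  shows "del v (alexander_dual V \<Delta>) = alexander_dual (V - {v}) (link v \<Delta>)"
proof -
  have "F \<subseteq> V \<and> V - F \<notin> \<Delta> \<and> v \<notin> F \<longleftrightarrow> F \<subseteq> V - {v} \<and> V - {v} - F \<notin> link v \<Delta>" for F
  proof (cases "v \<in> F")
    case False
    then have "insert v (V - {v} - F) = V - F" using assms by auto
    then have "V - {v} - F \<in> link v \<Delta> \<longleftrightarrow> V - F \<in> \<Delta>" by (simp add: link_def)
    then show ?thesis using False by auto
  qed auto
  then show ?thesis by (auto simp: del_def alexander_dual_def)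
qed

lemma alexander_dual_involution:
  assumes "\<Delta> \<subseteq> Pow V"
  shows "alexander_dual V (alexander_dual V \<Delta>) = \<Delta>"
proof -
  have "V - (V - F) = F" if "F \<subseteq> V" for F using that by auto
  then show ?thesis using assms by (auto simp: alexander_dual_def)
qed

text \<open>A face \<open>F\<close> of the link in the dual corresponds to the non-face
  \<open>N = V - insert v F\<close>. Exchanging \<open>w\<close> for \<open>v\<close> in
  \<open>N\<close> yields the complement of \<open>insert w F\<close>, so \<open>F\<close> is not
  maximal in the deletion. The assumption on \<open>V - {v}\<close> says that \<open>v\<close> is a
  vertex of the dual.\<close>

lemma shedding_alexander_dual:
  assumes "v \<in> V" "V - {v} \<notin> \<Delta>"
    and exch: "\<And>N. N \<subseteq> V - {v} \<Longrightarrow> N \<notin> \<Delta> \<Longrightarrow> \<exists>w\<in>N. insert v (N - {w}) \<notin> \<Delta>"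
  shows "shedding v (alexander_dual V \<Delta>)"
proof -
  have False if link: "F \<in> link v (alexander_dual V \<Delta>)"
    and del: "F \<in> facets (del v (alexander_dual V \<Delta>))"
    for F
  proof -
    have F: "v \<notin> F" "F \<subseteq> V" "V - insert v F \<notin> \<Delta>"
      using link by (auto simp: link_def alexander_dual_def)
    obtain w where w: "w \<in> V - insert v F" "insert v (V - insert v F - {w}) \<notin> \<Delta>"
      using exch[of "V - insert v F"] F by auto
    moreover have "insert v (V - insert v F - {w}) = V - insert w F"
      using F w(1) assms(1) by auto
    ultimately have "insert w F \<in> del v (alexander_dual V \<Delta>)"
      using F by (auto simp: del_def alexander_dual_def)
    then have "insert w F = F" using del unfolding facets_def by blast
    then show False using w(1) by auto
  qed
  moreover have "v \<in> vertices (alexander_dual V \<Delta>)"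
    using assms(1,2) by (simp add: vertices_def alexander_dual_def)
  ultimately show ?thesis unfolding shedding_def facets_def by blast
qed

lemma vertex_decomposable_alexander_dual_step:
  assumes \<Delta>: "simplicial_complex_on V \<Delta>" and v: "v \<in> V"
    and exch: "\<And>N. N \<subseteq> V - {v} \<Longrightarrow> N \<notin> \<Delta> \<Longrightarrow> \<exists>w\<in>N. insert v (N - {w}) \<notin> \<Delta>"
    and link: "vertex_decomposable (alexander_dual (V - {v}) (link v \<Delta>))"
    and del: "vertex_decomposable (alexander_dual (V - {v}) (del v \<Delta>))"
  shows "vertex_decomposable (alexander_dual V \<Delta>)"
proof (cases "V - {v} \<in> \<Delta>")
  \<comment> \<open>Here \<open>v\<close> is not a vertex of the dual, so the dual equals its own
    deletion and nothing has to be shed.\<close>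
  case True
  have "V - F \<in> \<Delta>" if "v \<in> F" for F
  proof -
    have "V - F \<subseteq> V - {v}" using that by auto
    then show ?thesis using True \<Delta> unfolding simplicial_complex_on_def by blast
  qed
  then have "alexander_dual V \<Delta> = del v (alexander_dual V \<Delta>)"
    by (auto simp: alexander_dual_def del_def)
  then show ?thesis using link del_alexander_dual[OF v] by simp
next
  case False
  then show ?thesis
    using vertex_decomposable.shed[OF shedding_alexander_dual[OF v False exch]] link del
    by (simp add: link_alexander_dual[OF v] del_alexander_dual[OF v])
qed

section \<open>Links, deletions and the exchange property under chordality\<close>

lemma simplicial_complex_on_link:
  assumes "simplicial_complex_on V \<Delta>"
  shows "simplicial_complex_on (V - {v}) (link v \<Delta>)"
proof -
  have "G \<in> link v \<Delta>" if "F \<in> link v \<Delta>" "G \<subseteq> F" for F G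
  proof -
    have "insert v G \<subseteq> insert v F" using that by auto
    moreover have "insert v F \<in> \<Delta>" "v \<notin> G" using that by (auto simp: link_def)
    ultimately show ?thesis using assms by (simp add: simplicial_complex_on_def link_def)
  qed
  moreover have "link v \<Delta> \<subseteq> Pow (V - {v})"
    using assms unfolding simplicial_complex_on_def link_def by blast
  ultimately show ?thesis using assms by (simp add: simplicial_complex_on_def)
qed

lemma simplicial_complex_on_del:
  assumes "simplicial_complex_on V \<Delta>"
  shows "simplicial_complex_on (V - {v}) (del v \<Delta>)"
  using assms by (auto simp: simplicial_complex_on_def del_def)

text \<open>The labels need not be \<open>1, \<dots>, n\<close>, nor even distinct, so that links and deletions keep the
  labels of \<open>\<Delta>\<close>.\<close>

definition E_chordal_wrt :: "('a \<Rightarrow> nat) \<Rightarrow> 'a set set \<Rightarrow> bool" where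
  "E_chordal_wrt l \<Delta> \<longleftrightarrow>
     (\<forall>f\<in>\<Delta>. \<forall>g\<in>\<Delta>. f \<noteq> g \<and> card f = card g \<and> Max (l ` f) = Max (l ` g) \<longrightarrow>
       (\<forall>h. h \<subseteq> f \<union> g \<and> card h = card f \<longrightarrow> h \<in> \<Delta>))"

lemma E_chordal_wrtD:
  assumes "E_chordal_wrt l \<Delta>" "f \<in> \<Delta>" "g \<in> \<Delta>" "f \<noteq> g" "card f = card g"
    "Max (l ` f) = Max (l ` g)" "h \<subseteq> f \<union> g" "card h = card f"
  shows "h \<in> \<Delta>"
  using assms unfolding E_chordal_wrt_def by blast

lemma E_chordal_wrt_del:
  assumes "E_chordal_wrt l \<Delta>"
  shows "E_chordal_wrt l (del v \<Delta>)"
  unfolding E_chordal_wrt_def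
proof (intro ballI allI impI)
  fix f g h
  assume "f \<in> del v \<Delta>" "g \<in> del v \<Delta>"
    and "f \<noteq> g \<and> card f = card g \<and> Max (l ` f) = Max (l ` g)" "h \<subseteq> f \<union> g \<and> card h = card f"
  then show "h \<in> del v \<Delta>" using E_chordal_wrtD[OF assms, of f g h] by (auto simp: del_def)
qed

lemma ex_max_image:
  fixes l :: "'a \<Rightarrow> 'b::linorder"
  assumes "finite A" "A \<noteq> {}"
  shows "\<exists>v\<in>A. \<forall>u\<in>A. l u \<le> l v"
proof -
  have "Max (l ` A) \<in> l ` A" using assms by (intro Max_in) auto
  then obtain v where "v \<in> A" "Max (l ` A) = l v" by auto
  then show ?thesis using assms(1) Max_ge[of "l ` A"] by auto
qed

lemma Max_image_insert_top:
  fixes l :: "'a \<Rightarrow> 'b::linorder"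
  assumes "finite f" "\<And>u. u \<in> f \<Longrightarrow> l u \<le> l v"
  shows "Max (l ` insert v f) = l v"
  using assms by (intro Max_eqI) auto

text \<open>Adding a top element \<open>v\<close> to two faces of the link gives both the maximum
  \<open>l v\<close>, so the condition in \<open>\<Delta>\<close> applies to the enlarged
  sets.\<close>

lemma E_chordal_wrt_link_top:
  assumes \<Delta>: "simplicial_complex_on V \<Delta>" and chordal: "E_chordal_wrt l \<Delta>"
    and top: "\<And>u. u \<in> V \<Longrightarrow> l u \<le> l v"
  shows "E_chordal_wrt l (link v \<Delta>)"
  unfolding E_chordal_wrt_def
proof (intro ballI allI impI)
  fix f g h
  assume f: "f \<in> link v \<Delta>" and g: "g \<in> link v \<Delta>"
    and fg: "f \<noteq> g \<and> card f = card g \<and> Max (l ` f) = Max (l ` g)"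
    and h: "h \<subseteq> f \<union> g \<and> card h = card f"
  have sub: "f \<subseteq> V" "g \<subseteq> V" and notin: "v \<notin> f" "v \<notin> g" "v \<notin> h"
    using f g h \<Delta> by (auto simp: simplicial_complex_on_def link_def)
  then have fin: "finite f" "finite g" "finite h"
    using \<Delta> h by (auto simp: simplicial_complex_on_def intro: finite_subset)
  have "Max (l ` insert v f) = Max (l ` insert v g)"
    using Max_image_insert_top[of f l v] Max_image_insert_top[of g l v] fin sub top by (metis subsetD)
  moreover have "insert v f \<noteq> insert v g" using notin fg by (simp add: insert_ident)
  moreover have "insert v f \<in> \<Delta>" "insert v g \<in> \<Delta>" using f g by (simp_all add: link_def)
  ultimately have "insert v h \<in> \<Delta>"
    using E_chordal_wrtD[OF chordal, of "insert v f" "insert v g" "insert v h"] fg h notin fin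
    by auto
  then show "h \<in> link v \<Delta>" using notin by (simp add: link_def)
qed

text \<open>The bound on \<open>card N\<close> supplies two different exchanges to compare; from a
  singleton only \<open>{v}\<close> would arise.\<close>

lemma E_chordal_wrt_exchange:
  assumes chordal: "E_chordal_wrt l \<Delta>" and fin: "finite N" and top: "\<And>u. u \<in> N \<Longrightarrow> l u \<le> l v"
    and N: "v \<notin> N" "N \<notin> \<Delta>" "card N \<ge> 2"
  shows "\<exists>w\<in>N. insert v (N - {w}) \<notin> \<Delta>"
proof (rule ccontr)
  assume *: "\<not> (\<exists>w\<in>N. insert v (N - {w}) \<notin> \<Delta>)"
  obtain a b where ab: "a \<in> N" "b \<in> N" "a \<noteq> b"
    using N(3) fin by (metis card_le_Suc0_iff_eq not_less_eq_eq numeral_2_eq_2)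
  let ?f = "\<lambda>w. insert v (N - {w})"
  have "card (?f w) = card N" if "w \<in> N" for w
    using that fin N by (simp add: card.insert_remove)
  moreover have "Max (l ` ?f w) = l v" for w
    using fin top by (intro Max_image_insert_top) auto
  moreover have "?f a \<noteq> ?f b" using ab N(1) by auto
  moreover have "N \<subseteq> ?f a \<union> ?f b" using ab by auto
  moreover have "?f a \<in> \<Delta>" "?f b \<in> \<Delta>" using ab * by blast+
  ultimately have "N \<in> \<Delta>"
    using E_chordal_wrtD[OF chordal, of "?f a" "?f b" N] ab by metis
  then show False using N by simp
qed

section \<open>Induction on the ground set\<close>

lemma vertex_decomposable_alexander_dual:
  assumes "simplicial_complex_on V \<Delta>" "E_chordal_wrt l \<Delta>"
  shows "vertex_decomposable (alexander_dual V \<Delta>)"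
  using assms
proof (induction "card V" arbitrary: V \<Delta>)
  case 0
  then have "V = {}" by (simp add: simplicial_complex_on_def)
  then have "alexander_dual V \<Delta> \<subseteq> {{}}" by (auto simp: alexander_dual_def)
  then have "alexander_dual V \<Delta> = {} \<or> alexander_dual V \<Delta> = {{}}"
    by (simp add: subset_singleton_iff)
  then show ?case by (metis vertex_decomposable.irrelevant vertex_decomposable.void)
next
  case (Suc n)
  note \<Delta> = Suc.prems(1)
  have fin: "finite V" and sub: "\<Delta> \<subseteq> Pow V"
    and down: "\<And>F G. F \<in> \<Delta> \<Longrightarrow> G \<subseteq> F \<Longrightarrow> G \<in> \<Delta>"
    using \<Delta> unfolding simplicial_complex_on_def by blast+
  have card: "n = card (V - {v})" if "v \<in> V" for v using Suc.hyps(2) that by simp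
  have del: "vertex_decomposable (alexander_dual (V - {v}) (del v \<Delta>))" if "v \<in> V" for v
    using Suc.hyps(1)[OF card[OF that]] simplicial_complex_on_del[OF \<Delta>]
      E_chordal_wrt_del[OF Suc.prems(2)] by blast
  have void: "alexander_dual W {} = Pow W" for W :: "'a set"
    by (auto simp: alexander_dual_def)
  \<comment> \<open>The element to remove is a non-vertex if there is one, and otherwise the element
    with the largest label. The void complex is separate: its dual is a full simplex.\<close>
  consider "\<Delta> = {}" | w where "\<Delta> \<noteq> {}" "w \<in> V" "{w} \<notin> \<Delta>"
    | "\<Delta> \<noteq> {}" "\<And>w. w \<in> V \<Longrightarrow> {w} \<in> \<Delta>" by blast
  then show ?case
  proof cases
    case 1
    then show ?thesis using vertex_decomposable.simplex[OF fin] void by simp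
  next
    case 2
    have nonface: "insert w F \<notin> \<Delta>" for F using 2 down[of "insert w F" "{w}"] by auto
    then have "link w \<Delta> = {}" by (simp add: link_def)
    then have link: "vertex_decomposable (alexander_dual (V - {w}) (link w \<Delta>))"
      using fin void vertex_decomposable.simplex by (metis finite_Diff)
    \<comment> \<open>Any element of \<open>N\<close> can be exchanged for \<open>w\<close>, since
      no face contains \<open>w\<close>; it only remains to see that \<open>N\<close> is
      nonempty.\<close>
    have "{} \<in> \<Delta>" using 2 down by blast
    then have "N \<noteq> {}" if "N \<notin> \<Delta>" for N using that by auto
    then show ?thesis
      using vertex_decomposable_alexander_dual_step[OF \<Delta> 2(2) _ link del[OF 2(2)]] nonface
      by blast
  next
    case 3
    have "V \<noteq> {}" using Suc.hyps(2) by auto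
    then obtain v where v: "v \<in> V" and top: "\<And>u. u \<in> V \<Longrightarrow> l u \<le> l v"
      using ex_max_image[OF fin, of l] by blast
    have link: "vertex_decomposable (alexander_dual (V - {v}) (link v \<Delta>))"
      using Suc.hyps(1)[OF card[OF v]] simplicial_complex_on_link[OF \<Delta>]
        E_chordal_wrt_link_top[OF \<Delta> Suc.prems(2) top] by blast
    have "\<exists>w\<in>N. insert v (N - {w}) \<notin> \<Delta>" if N: "N \<subseteq> V - {v}" "N \<notin> \<Delta>" for N
    proof (rule E_chordal_wrt_exchange[OF Suc.prems(2)])
      show finN: "finite N" using N fin by (auto intro: finite_subset)
      \<comment> \<open>The empty set and all singletons are faces, so a non-face has at least two
        elements.\<close>
      have "{} \<in> \<Delta>" using 3 down by blast
      then have "card N \<noteq> 0" using N finN by auto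
      moreover have "card N \<noteq> 1" using N 3 by (auto simp: card_1_singleton_iff)
      ultimately show "card N \<ge> 2" by linarith
    qed (use N top in auto)
    then show ?thesis
      using vertex_decomposable_alexander_dual_step[OF \<Delta> v _ link del[OF v]] by blast
  qed
qed

lemma skeleton_E_chordal_imp_E_chordal_wrt:
  assumes "skeleton_E_chordal \<Delta>"
  shows "\<exists>l. E_chordal_wrt l \<Delta>"
  using assms unfolding skeleton_E_chordal_def E_chordal_wrt_def by blast

section \<open>Stars and their duals\<close>

definition star :: "'a \<Rightarrow> 'a set \<Rightarrow> 'a set set" where
  "star c A = (\<Union>i\<in>A. Pow {c, i})"

text \<open>Leaves are shed one by one until a single edge, a simplex, is left. The link of a leaf
  has the only facet \<open>{c}\<close>, which any remaining leaf extends to an edge.\<close>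

lemma vertex_decomposable_star:
  assumes "finite A" "A \<noteq> {}" "c \<notin> A"
  shows "vertex_decomposable (star c A)"
  using assms
proof (induction A rule: finite_ne_induct)
  case (singleton a)
  then show ?case using vertex_decomposable.simplex[of "{c, a}"] by (simp add: star_def)
next
  case (insert a A)
  have ac: "a \<noteq> c" using insert.prems by auto
  have link: "link a (star c (insert a A)) = Pow {c}"
    using insert.hyps ac by (auto simp: link_def star_def)
  \<comment> \<open>The faces \<open>{}\<close> and \<open>{c}\<close> left over from the removed
    edge already lie in the smaller star because \<open>A\<close> is nonempty.\<close>
  have "Pow {c, a} \<inter> {F. a \<notin> F} \<subseteq> star c A"
    using insert.hyps(2) by (auto simp: star_def)
  then have del: "del a (star c (insert a A)) = star c A"
    using insert.hyps(3) ac by (auto simp: del_def star_def)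
  obtain b where b: "b \<in> A" using insert.hyps by blast
  have "facets (Pow {c}) = {{c}}" by (auto simp: facets_def)
  moreover have "{c} \<notin> facets (star c A)"
  proof
    assume "{c} \<in> facets (star c A)"
    moreover have "{c, b} \<in> star c A" using b by (auto simp: star_def)
    ultimately have "{c, b} = {c}" unfolding facets_def by blast
    then show False using b insert.prems by auto
  qed
  ultimately have "shedding a (star c (insert a A))"
    unfolding shedding_def link del by (auto simp: vertices_def star_def)
  then show ?case
    using vertex_decomposable.shed[of a "star c (insert a A)"] insert.IH insert.prems
      vertex_decomposable.simplex[of "{c}"] by (simp add: link del)
qed

lemma complex_dim_star:
  assumes "finite A" "A \<noteq> {}" "c \<notin> A"
  shows "complex_dim (star c A) = 1"
  unfolding complex_dim_def
proof (rule Max_eqI)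
  show "finite ((\<lambda>F. int (card F) - 1) ` star c A)" using assms by (simp add: star_def)
next
  fix y
  assume "y \<in> (\<lambda>F. int (card F) - 1) ` star c A"
  then obtain F i where F: "y = int (card F) - 1" "F \<subseteq> {c, i}" by (auto simp: star_def)
  have "card F \<le> card {c, i}" using F by (intro card_mono) auto
  also have "\<dots> \<le> 2" by (simp add: card_insert_if)
  finally show "y \<le> 1" using F by simp
next
  obtain a where a: "a \<in> A" using assms by blast
  then have "int (card {c, a}) - 1 = 1" using assms by (auto simp: card_insert_if)
  moreover have "{c, a} \<in> star c A" using a by (auto simp: star_def)
  ultimately show "1 \<in> (\<lambda>F. int (card F) - 1) ` star c A" by (metis image_eqI)
qed

lemma not_E_chordal_wrt_dual_star:
  assumes "card A = 4" "c \<notin> A"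
  shows "\<not> E_chordal_wrt l (alexander_dual (insert c A) (star c A))"
proof
  let ?D = "alexander_dual (insert c A) (star c A)"
  assume chordal: "E_chordal_wrt l ?D"
  have "finite A" using assms(1) by (intro card_ge_0_finite) simp
  moreover have "A \<noteq> {}" using assms(1) by auto
  ultimately obtain i where i: "i \<in> A" and top: "\<And>u. u \<in> A \<Longrightarrow> l u \<le> l i"
    using ex_max_image[of A l] by blast
  have "card (A - {i}) = 3" using i assms by simp
  then obtain j k m where jkm: "A - {i} = {j, k, m}" "j \<noteq> k" "j \<noteq> m" "k \<noteq> m"
    by (auto simp: card_3_iff)
  then have A: "A = {i, j, k, m}" and distinct: "i \<noteq> j" "i \<noteq> k" "i \<noteq> m" using i by blast+
  have c: "c \<noteq> i" "c \<noteq> j" "c \<noteq> k" "c \<noteq> m" using assms A by auto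
  \<comment> \<open>Two leaves do not span an edge, so the first two sets are faces of the dual;
    \<open>{c, m}\<close> is an edge, so the third is not.\<close>
  have "insert c A - {c, i, j} = {k, m}" "insert c A - {c, i, k} = {j, m}"
    "insert c A - {i, j, k} = {c, m}"
    using A c distinct jkm by auto
  then have faces: "{c, i, j} \<in> ?D" "{c, i, k} \<in> ?D" and nonface: "{i, j, k} \<notin> ?D"
    using A c distinct jkm by (auto simp: alexander_dual_def star_def)
  \<comment> \<open>The centre may carry a larger label than \<open>i\<close>; the two maxima agree
    in either case.\<close>
  have "Max (l ` {c, i, j}) = max (l c) (l i)" "Max (l ` {c, i, k}) = max (l c) (l i)"
    using top[of j] top[of k] A by (auto simp: max_def)
  moreover have "card {c, i, j} = 3" "card {c, i, k} = 3" "card {i, j, k} = 3"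
    using c distinct jkm by auto
  moreover have "{c, i, j} \<noteq> {c, i, k}" using c distinct jkm by auto
  ultimately have "{i, j, k} \<in> ?D"
    using E_chordal_wrtD[OF chordal faces, of "{i, j, k}"] by auto
  then show False using nonface by simp
qed

text \<open>Removing one element leaves at least three, too many for a face of a star. This ensures
  that the counterexample uses its whole ground set as vertices.\<close>

lemma vertices_dual_star:
  assumes "card A \<ge> 3" "c \<notin> A"
  shows "vertices (alexander_dual (insert c A) (star c A)) = insert c A"
proof -
  have fin: "finite A" using assms(1) by (intro card_ge_0_finite) simp
  have "insert c A - {v} \<notin> star c A" if "v \<in> insert c A" for v
  proof
    assume "insert c A - {v} \<in> star c A"
    then obtain i where "insert c A - {v} \<subseteq> {c, i}" by (auto simp: star_def)
    then have "card (insert c A - {v}) \<le> card {c, i}" by (intro card_mono) auto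
    also have "\<dots> \<le> 2" by (simp add: card_insert_if)
    finally show False using assms fin that by (simp add: card_Diff_singleton)
  qed
  then show ?thesis by (auto simp: vertices_def alexander_dual_def)
qed

theorem theorem126:
  "(\<forall>(n::nat) (\<Delta>::nat set set).
      simplicial_complex_on {1..n} \<Delta> \<and> skeleton_E_chordal \<Delta> \<longrightarrow>
      vertex_decomposable (alexander_dual {1..n} \<Delta>)) \<and>
   (\<exists>(n::nat) (\<Delta>::nat set set).
      simplicial_complex_on {1..n} \<Delta> \<and> vertices \<Delta> = {1..n} \<and>
      complex_dim (alexander_dual {1..n} \<Delta>) = 1 \<and>
      vertex_decomposable (alexander_dual {1..n} \<Delta>) \<and>
      \<not> skeleton_E_chordal \<Delta>)"
proof (intro conjI allI impI)
  fix n and \<Delta> :: "nat set set"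
  assume "simplicial_complex_on {1..n} \<Delta> \<and> skeleton_E_chordal \<Delta>"
  then show "vertex_decomposable (alexander_dual {1..n} \<Delta>)"
    using skeleton_E_chordal_imp_E_chordal_wrt vertex_decomposable_alexander_dual by blast
next
  let ?A = "{2..5::nat}"
  \<comment> \<open>The counterexample is itself taken as a dual, so that its own dual is the star
    with centre 1 and leaves 2 to 5.\<close>
  let ?D = "alexander_dual {1..5} (star 1 ?A)"
  have V: "insert 1 ?A = {1..5}" by auto
  have A: "finite ?A" "?A \<noteq> {}" "1 \<notin> ?A" "card ?A = 4" by auto
  have star: "simplicial_complex_on {1..5} (star 1 ?A)"
    by (fastforce simp: simplicial_complex_on_def star_def)
  then have dual: "alexander_dual {1..5} ?D = star 1 ?A"
    by (intro alexander_dual_involution) (simp add: simplicial_complex_on_def)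
  have "simplicial_complex_on {1..5} ?D"
    using star by (rule simplicial_complex_on_alexander_dual)
  moreover have "vertices ?D = {1..5}" using vertices_dual_star[of ?A 1] A V by simp
  moreover have "complex_dim (alexander_dual {1..5} ?D) = 1"
    unfolding dual using A(1-3) by (rule complex_dim_star)
  moreover have "vertex_decomposable (alexander_dual {1..5} ?D)"
    unfolding dual using A(1-3) by (rule vertex_decomposable_star)
  moreover have "\<not> skeleton_E_chordal ?D"
    using skeleton_E_chordal_imp_E_chordal_wrt not_E_chordal_wrt_dual_star[OF A(4,3)] V by auto
  ultimately show "\<exists>n (\<Delta>::nat set set). simplicial_complex_on {1..n} \<Delta> \<and> vertices \<Delta> = {1..n} \<and>
      complex_dim (alexander_dual {1..n} \<Delta>) = 1 \<and>
      vertex_decomposable (alexander_dual {1..n} \<Delta>) \<and> \<not> skeleton_E_chordal \<Delta>"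
    by (intro exI[of _ 5] exI[of _ ?D] conjI)
qed

end
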